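(* For any partition $\alpha = \{k_1,k_2,\ldots,k_p\}$ of $n$ (with $p\ge 2$ blocks), we have $$ \mathrm{dist}(\mathbb{S}^n_+,\mathcal{FW}_{\alpha,2}^n) \leq\frac{p-2}{p}, \qquad \mathrm{dist}((\mathcal{FW}_{\alpha,2}^n)^*,\mathbb{S}^n_+) \leq \frac{p-2}{p}. $$
   Context: $\mathbb{S}^n$ denotes the real symmetric $n\times n$ matrices and $\mathbb{S}^n_+$ the positive semidefinite (PSD) ones. A partition of $n$ is an ordered list $\alpha=\{k_1,\ldots,k_p\}$ of positive integers with $\sum_{i=1}^p k_i=n$; throughout $p\ge 2$. Let $E_i^\alpha\in\mathbb{R}^{k_i\times n}$ be the $i$-th block row of $I_n$ when the rows of $I_n$ are split consecutively into blocks of sizes $k_1,\ldots,k_p$, and for $i\neq j$ let $E_{ij}^\alpha=\begin{bmatrix}(E_i^\alpha)^{\mathsf T} & (E_j^\alpha)^{\mathsf T}\end{bmatrix}^{\mathsf T}\in\mathbb{R}^{(k_i+k_j)\times n}$. The set $\mathcal{FW}_{\alpha,2}^n$ of block factor-width-two matrices consists of all $Z\in\mathbb{S}^n$ of the form $Z=\sum_{i=1}^{p-1}\sum_{j=i+1}^p (E^{\alpha}_{ij})^{\mathsf T} X_{ij} E^{\alpha}_{ij}$ for some $X_{ij}\in\mathbb{S}^{k_i+k_j}_+$. Its dual with respect to the trace inner product is $(\mathcal{FW}_{\alpha,2}^n)^* = \{X \in \mathbb{S}^n \mid E^{\alpha}_{ij} X (E^{\alpha}_{ij})^{\mathsf T}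 \succeq 0,\ 1\leq i < j \leq p\}$. With $\|\cdot\|_F$ the Frobenius norm, for a matrix $M$ and a set $\mathcal{D}$ put $\mathrm{dist}(M,\mathcal{D})=\inf_{N\in\mathcal{D}}\|M-N\|_F$, and define $$\mathrm{dist}(\mathbb{S}^n_+,\mathcal{FW}_{\alpha,2}^n)=\sup_{M \in \mathbb{S}^n_+,\ \|M\|_F = 1} \mathrm{dist}(M,\mathcal{FW}_{\alpha,2}^n),\qquad \mathrm{dist}((\mathcal{FW}_{\alpha,2}^n)^*,\mathbb{S}^n_+)=\sup_{M \in (\mathcal{FW}_{\alpha,2}^n)^*,\ \|M\|_F = 1} \mathrm{dist}(M,\mathbb{S}^n_+).$$ *)

theory Defs
  imports Complex_Main "Jordan_Normal_Form.Matrix"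
begin

section \<open>Symmetric and positive semidefinite matrices\<close>

definition sym_mats :: "nat \<Rightarrow> real mat set" where
  "sym_mats n = {A \<in> carrier_mat n n. transpose_mat A = A}"

definition psd_mats :: "nat \<Rightarrow> real mat set" where
  "psd_mats n = {A \<in> sym_mats n. \<forall>x \<in> carrier_vec n. 0 \<le> x \<bullet> (A *\<^sub>v x)}"

definition mat_trace :: "real mat \<Rightarrow> real" where
  "mat_trace A = (\<Sum>i<dim_row A. A $$ (i, i))"

definition trace_inner :: "real mat \<Rightarrow> real mat \<Rightarrow> real" where
  "trace_inner A B = mat_trace (transpose_mat A * B)"

definition frobenius_norm :: "real mat \<Rightarrow> real" where
  "frobenius_norm A = sqrt (\<Sum>i<dim_row A. \<Sum>j<dim_col A. (A $$ (i, j))\<^sup>2)"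

definition dual_cone :: "nat \<Rightarrow> real mat set \<Rightarrow> real mat set" where
  "dual_cone n C = {X \<in> sym_mats n. \<forall>Z \<in> C. 0 \<le> trace_inner X Z}"

section \<open>Block factor-width-two matrices\<close>

definition is_partition :: "nat list \<Rightarrow> nat \<Rightarrow> bool" where
  "is_partition \<alpha> n \<longleftrightarrow> (\<forall>k \<in> set \<alpha>. 0 < k) \<and> sum_list \<alpha> = n"

text \<open>Blocks are numbered from \<open>0\<close>; block \<open>i\<close> of the identity starts at row
  \<open>k\<^sub>0 + \<dots> + k\<^bsub>i-1\<^esub>\<close>.\<close>

definition block_row :: "nat \<Rightarrow> nat list \<Rightarrow> nat \<Rightarrow> real mat" where
  "block_row n \<alpha> i = mat (\<alpha> ! i) n (\<lambda>(r, c). 1\<^sub>m n $$ (sum_list (take i \<alpha>) + r, c))"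

definition block_pair :: "nat \<Rightarrow> nat list \<Rightarrow> nat \<Rightarrow> nat \<Rightarrow> real mat" where
  "block_pair n \<alpha> i j = block_row n \<alpha> i @\<^sub>r block_row n \<alpha> j"

definition index_pairs :: "nat \<Rightarrow> (nat \<times> nat) set" where
  "index_pairs p = {(i, j). i < j \<and> j < p}"

definition FW2 :: "nat \<Rightarrow> nat list \<Rightarrow> real mat set" where
  "FW2 n \<alpha> = {Z \<in> sym_mats n. \<exists>X :: nat \<Rightarrow> nat \<Rightarrow> real mat.
     (\<forall>(i, j) \<in> index_pairs (length \<alpha>). X i j \<in> psd_mats (\<alpha> ! i + \<alpha> ! j)) \<and>
     Z = finsum (module_mat TYPE(real) n n)
           (\<lambda>(i, j). transpose_mat (block_pair n \<alpha> i j) * X i j * block_pair n \<alpha> i j)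
           (index_pairs (length \<alpha>))}"

section \<open>Distances\<close>

definition mat_dist :: "real mat \<Rightarrow> real mat set \<Rightarrow> real" where
  "mat_dist M D = (INF N \<in> D. frobenius_norm (M - N))"

text \<open>For nonempty \<open>D\<close> every \<open>mat_dist M D\<close> is an infimum of a nonempty set bounded below
  by \<open>0\<close>; if \<open>D\<close> moreover contains the zero matrix, the supremum below is over numbers in
  \<open>[0, 1]\<close>. So no default value of the real infimum or supremum is involved for the cones
  considered here.\<close>

definition cone_dist :: "real mat set \<Rightarrow> real mat set \<Rightarrow> real" where
  "cone_dist C D = (SUP M \<in> {M \<in> C. frobenius_norm M = 1}. mat_dist M D)"

section \<open>The dual cone in terms of block pairs\<close>

lemma finite_index_pairs: "finite (index_pairs p)"
  by (rule finite_subset[of _ "{..<p} \<times> {..<p}"]) (auto simp: index_pairs_def)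

lemma block_pair_carrier [simp]: "block_pair n \<alpha> i j \<in> carrier_mat (\<alpha> ! i + \<alpha> ! j) n"
  unfolding block_pair_def by (rule carrier_append_rows) (auto simp: block_row_def)

lemma finsum_mat_carrier:
  assumes "finite I" "\<And>k. k \<in> I \<Longrightarrow> f k \<in> carrier_mat nr nc"
  shows "finsum (module_mat TYPE(real) nr nc) f I \<in> carrier_mat nr nc"
proof -
  interpret abelian_group "module_mat TYPE(real) nr nc"
    by (rule abelian_group_mat)
  show ?thesis
    using finsum_closed[of f I] assms by (auto simp: module_mat_simps)
qed

lemma index_finsum_mat:
  assumes "finite I" "\<And>k. k \<in> I \<Longrightarrow> f k \<in> carrier_mat nr nc" "r < nr" "c < nc"
  shows "finsum (module_mat TYPE(real) nr nc) f I $$ (r, c) = (\<Sum>k\<in>I. f k $$ (r, c))"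
proof -
  interpret abelian_group "module_mat TYPE(real) nr nc"
    by (rule abelian_group_mat)
  show ?thesis
    using assms(1,2)
  proof (induction I rule: finite_induct)
    case empty
    then show ?case using assms(3,4) by (simp add: module_mat_simps)
  next
    case (insert k I)
    have "finsum (module_mat TYPE(real) nr nc) f (insert k I)
        = f k + finsum (module_mat TYPE(real) nr nc) f I"
      using finsum_insert[of I k f] insert.hyps insert.prems by (auto simp: module_mat_simps)
    moreover have "finsum (module_mat TYPE(real) nr nc) f I \<in> carrier_mat nr nc"
      using insert by (intro finsum_mat_carrier) auto
    ultimately show ?case using insert assms(3,4) by auto
  qed
qed

lemma trace_inner_eq_sum:
  assumes "A \<in> carrier_mat m n" "B \<in> carrier_mat m n"
  shows "trace_inner A B = (\<Sum>i<m. \<Sum>j<n. A $$ (i, j) * B $$ (i, j))"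
proof -
  have "trace_inner A B = (\<Sum>j<n. \<Sum>i<m. A $$ (i, j) * B $$ (i, j))"
    using assms unfolding trace_inner_def mat_trace_def
    by (auto simp: scalar_prod_def atLeast0LessThan intro!: sum.cong)
  then show ?thesis by (subst sum.swap)
qed

lemma mat_trace_mult_comm:
  assumes "A \<in> carrier_mat m n" "B \<in> carrier_mat n m"
  shows "mat_trace (A * B) = mat_trace (B * A)"
proof -
  have "mat_trace (A * B) = (\<Sum>i<m. \<Sum>j<n. A $$ (i, j) * B $$ (j, i))"
    using assms unfolding mat_trace_def
    by (auto simp: scalar_prod_def atLeast0LessThan intro!: sum.cong)
  also have "\<dots> = (\<Sum>j<n. \<Sum>i<m. A $$ (i, j) * B $$ (j, i))" by (rule sum.swap)
  also have "\<dots> = mat_trace (B * A)"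
    using assms unfolding mat_trace_def
    by (auto simp: scalar_prod_def atLeast0LessThan mult.commute intro!: sum.cong)
  finally show ?thesis .
qed

lemma trace_inner_congruence:
  assumes E: "E \<in> carrier_mat m n" and X: "X \<in> carrier_mat n n" and P: "P \<in> carrier_mat m m"
  shows "trace_inner X (transpose_mat E * P * E) = trace_inner (E * X * transpose_mat E) P"
proof -
  let ?T = transpose_mat
  have E': "?T E \<in> carrier_mat n m" and X': "?T X \<in> carrier_mat n n"
    using E X by simp_all
  have EP: "?T E * P \<in> carrier_mat n m" by (rule mult_carrier_mat[OF E' P])
  have XEP: "?T X * (?T E * P) \<in> carrier_mat n m" by (rule mult_carrier_mat[OF X' EP])
  have XE: "?T X * ?T E \<in> carrier_mat n m" by (rule mult_carrier_mat[OF X' E'])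
  have "trace_inner X (?T E * P * E) = mat_trace (E * (?T X * (?T E * P)))"
    unfolding trace_inner_def assoc_mult_mat[OF X' EP E, symmetric]
    by (rule mat_trace_mult_comm[OF XEP E])
  also have "E * (?T X * (?T E * P)) = E * (?T X * ?T E) * P"
    unfolding assoc_mult_mat[OF X' E' P, symmetric] by (rule assoc_mult_mat[OF E XE P, symmetric])
  also have "E * (?T X * ?T E) = ?T (E * X * ?T E)"
    using transpose_mult[OF mult_carrier_mat[OF E X] E'] transpose_mult[OF E X] by simp
  finally show ?thesis unfolding trace_inner_def .
qed

lemma quadratic_form_eq_sum:
  assumes "A \<in> carrier_mat n n" "x \<in> carrier_vec n"
  shows "x \<bullet> (A *\<^sub>v x) = (\<Sum>i<n. \<Sum>j<n. x $ i * A $$ (i, j) * x $ j)"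
  using assms by (auto simp: scalar_prod_def atLeast0LessThan sum_distrib_left mult.assoc
      intro!: sum.cong)

lemma sum_mult_nonneg_of_psd:
  fixes A B :: "'i \<Rightarrow> 'i \<Rightarrow> real"
  assumes "finite S"
    and "\<And>x. 0 \<le> (\<Sum>i\<in>S. \<Sum>j\<in>S. x i * A i j * x j)"
    and "\<And>x. 0 \<le> (\<Sum>i\<in>S. \<Sum>j\<in>S. x i * B i j * x j)"
    and "\<And>i j. B i j = B j i"
  shows "0 \<le> (\<Sum>i\<in>S. \<Sum>j\<in>S. A i j * B i j)"
  using assms
proof (induction S arbitrary: B rule: finite_induct)
  case empty
  then show ?case by simp
next
  case (insert k S)
  note fin = insert.hyps(1) and k = insert.hyps(2)
  note psdA = insert.prems(1) and psdB = insert.prems(2) and symB = insert.prems(3)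
  have ins: "(\<Sum>i\<in>insert k S. \<Sum>j\<in>insert k S. h i j)
      = h k k + (\<Sum>j\<in>S. h k j) + (\<Sum>i\<in>S. h i k) + (\<Sum>i\<in>S. \<Sum>j\<in>S. h i j)"
    for h :: "'i \<Rightarrow> 'i \<Rightarrow> real"
    using fin k by (simp add: sum.distrib)
  have expand: "(\<Sum>i\<in>insert k S. \<Sum>j\<in>insert k S. x i * B i j * x j)
      = B k k * (x k)\<^sup>2 + 2 * x k * (\<Sum>i\<in>S. x i * B i k) + (\<Sum>i\<in>S. \<Sum>j\<in>S. x i * B i j * x j)"
    for x
  proof -
    have "(\<Sum>j\<in>S. x k * B k j * x j) = x k * (\<Sum>i\<in>S. x i * B i k)"
      by (simp add: sum_distrib_left symB[of k] ac_simps)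
    moreover have "(\<Sum>i\<in>S. x i * B i k * x k) = x k * (\<Sum>i\<in>S. x i * B i k)"
      by (simp add: sum_distrib_left ac_simps)
    ultimately show ?thesis unfolding ins by (simp add: power2_eq_square)
  qed
  have psdA': "0 \<le> (\<Sum>i\<in>S. \<Sum>j\<in>S. x i * A i j * x j)" for x
  proof -
    define y where "y = x(k := 0)"
    have "(\<Sum>i\<in>S. \<Sum>j\<in>S. y i * A i j * y j) = (\<Sum>i\<in>S. \<Sum>j\<in>S. x i * A i j * x j)"
      using k by (intro sum.cong) (auto simp: y_def)
    moreover have "y k = 0" by (simp add: y_def)
    ultimately show ?thesis using psdA[of y] unfolding ins by simp
  qed
  have quad: "0 \<le> B k k * t\<^sup>2 + 2 * t * (\<Sum>i\<in>S. x i * B i k) + (\<Sum>i\<in>S. \<Sum>j\<in>S. x i * B i j * x j)"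
    for x t
  proof -
    define y where "y = x(k := t)"
    have eq: "(\<Sum>i\<in>S. \<Sum>j\<in>S. y i * B i j * y j) = (\<Sum>i\<in>S. \<Sum>j\<in>S. x i * B i j * x j)"
      "(\<Sum>i\<in>S. y i * B i k) = (\<Sum>i\<in>S. x i * B i k)"
      using k by (auto simp: y_def intro!: sum.cong)
    show ?thesis using psdB[of y] unfolding expand eq by (simp add: y_def)
  qed
  have Bkk: "0 \<le> B k k" using quad[of 1 "\<lambda>_. 0"] by simp
  show ?case
  proof (cases "B k k = 0")
    case True
    have z: "B i k = 0" if "i \<in> S" for i
    proof (rule ccontr)
      assume nz: "B i k \<noteq> 0"
      define x where "x = (\<lambda>l. if l = i then 1 else (0::real))"
      have lin: "(\<Sum>l\<in>S. x l * B l k) = B i k"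
        using that fin by (simp add: x_def if_distrib[where f = "\<lambda>a. a * _"] cong: if_cong)
      define c where "c = (\<Sum>i\<in>S. \<Sum>j\<in>S. x i * B i j * x j)"
      have "0 \<le> 2 * t * B i k + c" for t
        using quad[of t x] True lin by (simp add: c_def)
      from this[of "- (c + 1) / (2 * B i k)"] nz show False by (simp add: field_simps)
    qed
    have "0 \<le> (\<Sum>i\<in>S. \<Sum>j\<in>S. A i j * B i j)"
      by (rule insert.IH[OF psdA' _ symB]) (use quad[of 0] in simp)
    moreover have "B k i = 0" if "i \<in> S" for i using z[OF that] symB[of i k] by metis
    ultimately show ?thesis unfolding ins using True z by simp
  next
    case False
    with Bkk have pos: "0 < B k k" by simp
    define B' where "B' = (\<lambda>i j. B i j - B i k * B j k / B k k)"
    have split: "(\<Sum>i\<in>S. \<Sum>j\<in>S. x i * B' i j * x j)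
       = (\<Sum>i\<in>S. \<Sum>j\<in>S. x i * B i j * x j) - (\<Sum>i\<in>S. x i * B i k)\<^sup>2 / B k k" for x
      unfolding B'_def power2_eq_square sum_product sum_divide_distrib sum_subtractf[symmetric]
      by (intro sum.cong refl) (simp add: algebra_simps)
    have psd': "0 \<le> (\<Sum>i\<in>S. \<Sum>j\<in>S. x i * B' i j * x j)" for x
      using quad[of "- (\<Sum>i\<in>S. x i * B i k) / B k k" x] pos unfolding split
      by (simp add: power2_eq_square field_simps)
    have IH: "0 \<le> (\<Sum>i\<in>S. \<Sum>j\<in>S. A i j * B' i j)"
    proof (rule insert.IH[OF psdA' psd'])
      show "B' i j = B' j i" for i j
        unfolding B'_def by (subst symB[of i j]) (simp add: mult.commute)
    qed
    have row0: "B' k j = 0" "B' j k = 0" for j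
    proof -
      show "B' j k = 0" using pos by (simp add: B'_def)
      show "B' k j = 0" unfolding B'_def by (subst symB[of k j]) (use pos in simp)
    qed
    have "(\<Sum>i\<in>insert k S. \<Sum>j\<in>insert k S. A i j * B' i j) = (\<Sum>i\<in>S. \<Sum>j\<in>S. A i j * B' i j)"
      unfolding ins by (simp add: row0)
    moreover have "(\<Sum>i\<in>insert k S. \<Sum>j\<in>insert k S. A i j * B i j)
       = (\<Sum>i\<in>insert k S. \<Sum>j\<in>insert k S. A i j * B' i j)
         + (\<Sum>i\<in>insert k S. \<Sum>j\<in>insert k S. B i k * A i j * B j k) / B k k"
      unfolding B'_def sum_divide_distrib sum.distrib[symmetric]
      by (intro sum.cong refl) (simp add: algebra_simps)
    ultimately show ?thesis using IH psdA[of "\<lambda>i. B i k"] pos by simp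
  qed
qed

lemma trace_inner_psd_nonneg:
  assumes "A \<in> psd_mats n" "B \<in> psd_mats n"
  shows "0 \<le> trace_inner A B"
proof -
  have A: "A \<in> carrier_mat n n" and B: "B \<in> carrier_mat n n" and sB: "transpose_mat B = B"
    using assms by (auto simp: psd_mats_def sym_mats_def)
  have form: "0 \<le> (\<Sum>i<n. \<Sum>j<n. x i * C $$ (i, j) * x j)" if "C \<in> psd_mats n" for x C
  proof -
    have "C \<in> carrier_mat n n" "0 \<le> vec n x \<bullet> (C *\<^sub>v vec n x)"
      using that by (auto simp: psd_mats_def sym_mats_def)
    then show ?thesis using quadratic_form_eq_sum[of C n "vec n x"] by simp
  qed
  define b where "b = (\<lambda>i j. if i < n \<and> j < n then B $$ (i, j) else 0)"
  have "0 \<le> (\<Sum>i<n. \<Sum>j<n. A $$ (i, j) * b i j)"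
  proof (rule sum_mult_nonneg_of_psd)
    show "0 \<le> (\<Sum>i<n. \<Sum>j<n. x i * b i j * x j)" for x
      using form[OF assms(2), of x] by (simp add: b_def)
    show "b i j = b j i" for i j
    proof (cases "i < n \<and> j < n")
      case True
      then have "transpose_mat B $$ (i, j) = B $$ (j, i)" using B by auto
      then show ?thesis using sB True by (simp add: b_def)
    qed (auto simp: b_def)
  qed (use form[OF assms(1)] in auto)
  then show ?thesis by (simp add: trace_inner_eq_sum[OF A B] b_def)
qed

theorem dual_cone_FW2:
  "dual_cone n (FW2 n \<alpha>) = {X \<in> sym_mats n. \<forall>(i, j) \<in> index_pairs (length \<alpha>).
     block_pair n \<alpha> i j * X * transpose_mat (block_pair n \<alpha> i j) \<in> psd_mats (\<alpha> ! i + \<alpha> ! j)}"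
  (is "_ = ?R")
proof -
  let ?I = "index_pairs (length \<alpha>)"
  let ?E = "block_pair n \<alpha>"
  let ?t = "\<lambda>P (i, j). transpose_mat (?E i j) * P i j * ?E i j"
  let ?F = "\<lambda>P. finsum (module_mat TYPE(real) n n) (?t P) ?I"
  let ?k = "\<lambda>i j. \<alpha> ! i + \<alpha> ! j"
  have term_carrier: "?t P ij \<in> carrier_mat n n" for P ij
  proof -
    obtain i j where ij: "ij = (i, j)" by (cases ij)
    show ?thesis
      using carrier_matD(2)[OF block_pair_carrier[of n \<alpha> i j]] by (intro carrier_matI) (simp_all add: ij)
  qed
  have F_carrier: "?F P \<in> carrier_mat n n" for P
    using term_carrier by (intro finsum_mat_carrier finite_index_pairs)
  have tr: "trace_inner X (?F P)
      = (\<Sum>(i, j)\<in>?I. trace_inner (?E i j * X * transpose_mat (?E i j)) (P i j))"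
    if X: "X \<in> carrier_mat n n" and P: "\<And>i j. (i, j) \<in> ?I \<Longrightarrow> P i j \<in> carrier_mat (?k i j) (?k i j)"
    for X P
  proof -
    have "trace_inner X (?F P) = (\<Sum>r<n. \<Sum>c<n. \<Sum>ij\<in>?I. X $$ (r, c) * ?t P ij $$ (r, c))"
      unfolding trace_inner_eq_sum[OF X F_carrier]
      by (intro sum.cong refl)
        (simp only: index_finsum_mat[OF finite_index_pairs term_carrier] lessThan_iff sum_distrib_left)
    also have "\<dots> = (\<Sum>ij\<in>?I. \<Sum>r<n. \<Sum>c<n. X $$ (r, c) * ?t P ij $$ (r, c))"
      (is "(\<Sum>r<n. \<Sum>c<n. \<Sum>ij\<in>?I. ?g ij r c) = _")
    proof -
      have "(\<Sum>c<n. \<Sum>ij\<in>?I. ?g ij r c) = (\<Sum>ij\<in>?I. \<Sum>c<n. ?g ij r c)" for r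
        by (rule sum.swap)
      then have "(\<Sum>r<n. \<Sum>c<n. \<Sum>ij\<in>?I. ?g ij r c) = (\<Sum>r<n. \<Sum>ij\<in>?I. \<Sum>c<n. ?g ij r c)"
        by (rule sum.cong[OF refl])
      also have "\<dots> = (\<Sum>ij\<in>?I. \<Sum>r<n. \<Sum>c<n. ?g ij r c)" by (rule sum.swap)
      finally show ?thesis .
    qed
    also have "\<dots> = (\<Sum>ij\<in>?I. trace_inner X (?t P ij))"
      by (simp only: trace_inner_eq_sum[OF X term_carrier])
    also have "\<dots> = (\<Sum>(i, j)\<in>?I. trace_inner (?E i j * X * transpose_mat (?E i j)) (P i j))"
      by (intro sum.cong refl)
        (auto intro!: trace_inner_congruence[OF block_pair_carrier X P])
    finally show ?thesis .
  qed
  have sym_index: "M $$ (c, r) = M $$ (r, c)"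
    if "M \<in> carrier_mat n n" "transpose_mat M = M" "r < n" "c < n" for M :: "real mat" and r c
    using that index_transpose_mat(1)[of r M c] by simp
  have F_mem: "?F P \<in> FW2 n \<alpha>" if P: "\<And>i j. (i, j) \<in> ?I \<Longrightarrow> P i j \<in> psd_mats (?k i j)" for P
  proof -
    have symt: "transpose_mat (?t P ij) = ?t P ij" if ij: "ij \<in> ?I" for ij
    proof -
      obtain i j where [simp]: "ij = (i, j)" by (cases ij)
      have c: "P i j \<in> carrier_mat (?k i j) (?k i j)" "transpose_mat (P i j) = P i j"
        using P[of i j] ij by (auto simp: psd_mats_def sym_mats_def)
      have E: "?E i j \<in> carrier_mat (?k i j) n" "transpose_mat (?E i j) \<in> carrier_mat n (?k i j)"
        by auto
      have "transpose_mat (transpose_mat (?E i j) * P i j * ?E i j)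
          = transpose_mat (?E i j) * (transpose_mat (P i j) * ?E i j)"
        using transpose_mult[OF mult_carrier_mat[OF E(2) c(1)] E(1)] transpose_mult[OF E(2) c(1)]
        by simp
      also have "\<dots> = transpose_mat (?E i j) * P i j * ?E i j"
        unfolding c(2) by (rule assoc_mult_mat[OF E(2) c(1) E(1), symmetric])
      finally show ?thesis by simp
    qed
    have "transpose_mat (?F P) = ?F P"
    proof (rule eq_matI)
      fix r c assume "r < dim_row (?F P)" "c < dim_col (?F P)"
      then have rc: "r < n" "c < n" using F_carrier[of P] by auto
      have "?t P ij $$ (c, r) = ?t P ij $$ (r, c)" if "ij \<in> ?I" for ij
        by (rule sym_index[OF term_carrier symt[OF that] rc])
      then have "?F P $$ (c, r) = ?F P $$ (r, c)"
        unfolding index_finsum_mat[OF finite_index_pairs term_carrier rc(2,1)]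
          index_finsum_mat[OF finite_index_pairs term_carrier rc]
        by (intro sum.cong refl)
      then show "transpose_mat (?F P) $$ (r, c) = ?F P $$ (r, c)"
        using F_carrier[of P] rc by auto
    qed (use F_carrier[of P] in auto)
    then have "?F P \<in> sym_mats n" using F_carrier by (simp add: sym_mats_def)
    then show ?thesis unfolding FW2_def using P by blast
  qed
  have zero_psd: "0\<^sub>m m m \<in> psd_mats m" for m
    by (auto simp: psd_mats_def sym_mats_def quadratic_form_eq_sum[OF zero_carrier_mat])
  show ?thesis
  proof (intro equalityI subsetI)
    fix X assume dual: "X \<in> dual_cone n (FW2 n \<alpha>)"
    then have Xs: "X \<in> sym_mats n" and X: "X \<in> carrier_mat n n" and sX: "transpose_mat X = X"
      by (auto simp: dual_cone_def sym_mats_def)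
    have "?E a b * X * transpose_mat (?E a b) \<in> psd_mats (?k a b)" if ab: "(a, b) \<in> ?I" for a b
    proof -
      let ?Y = "?E a b * X * transpose_mat (?E a b)"
      have E: "?E a b \<in> carrier_mat (?k a b) n" "transpose_mat (?E a b) \<in> carrier_mat n (?k a b)"
        by auto
      have Y: "?Y \<in> carrier_mat (?k a b) (?k a b)"
        by (rule mult_carrier_mat[OF mult_carrier_mat[OF E(1) X] E(2)])
      have "transpose_mat ?Y = ?E a b * (X * transpose_mat (?E a b))"
        using transpose_mult[OF mult_carrier_mat[OF E(1) X] E(2)] transpose_mult[OF E(1) X] sX
        by simp
      then have sY: "transpose_mat ?Y = ?Y" using assoc_mult_mat[OF E(1) X E(2)] by simp
      have "0 \<le> x \<bullet> (?Y *\<^sub>v x)" if x: "x \<in> carrier_vec (?k a b)" for x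
      proof -
        define Q where "Q = mat (?k a b) (?k a b) (\<lambda>(r, c). x $ r * x $ c)"
        have Qc: "Q \<in> carrier_mat (?k a b) (?k a b)" by (simp add: Q_def)
        have Q: "Q \<in> psd_mats (?k a b)"
        proof -
          have "0 \<le> y \<bullet> (Q *\<^sub>v y)" if y: "y \<in> carrier_vec (?k a b)" for y
          proof -
            have "y \<bullet> (Q *\<^sub>v y) = (\<Sum>i<?k a b. y $ i * x $ i)\<^sup>2"
              unfolding quadratic_form_eq_sum[OF Qc y] power2_eq_square sum_product
              by (intro sum.cong refl) (simp add: Q_def)
            then show ?thesis by simp
          qed
          moreover have "transpose_mat Q = Q"
            by (rule eq_matI) (auto simp: Q_def)
          ultimately show ?thesis using Qc by (simp add: psd_mats_def sym_mats_def)
        qed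
        define P where "P = (\<lambda>i j. if (i, j) = (a, b) then Q else 0\<^sub>m (?k i j) (?k i j))"
        have P: "P i j \<in> psd_mats (?k i j)" for i j using Q zero_psd by (auto simp: P_def)
        have "0 \<le> trace_inner X (?F P)" using dual F_mem[of P] P by (auto simp: dual_cone_def)
        also have "\<dots> = (\<Sum>(i, j)\<in>?I. trace_inner (?E i j * X * transpose_mat (?E i j)) (P i j))"
          using P by (intro tr[OF X]) (auto simp: psd_mats_def sym_mats_def)
        also have "\<dots> = (\<Sum>ij\<in>?I. if ij = (a, b) then trace_inner ?Y Q else 0)"
        proof (intro sum.cong refl)
          fix ij assume "ij \<in> ?I"
          obtain i j where [simp]: "ij = (i, j)" by (cases ij)
          have E: "?E i j \<in> carrier_mat (?k i j) n" "transpose_mat (?E i j) \<in> carrier_mat n (?k i j)"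
            by auto
          have "?E i j * X * transpose_mat (?E i j) \<in> carrier_mat (?k i j) (?k i j)"
            by (rule mult_carrier_mat[OF mult_carrier_mat[OF E(1) X] E(2)])
          from trace_inner_eq_sum[OF this zero_carrier_mat]
          show "(case ij of (i, j) \<Rightarrow> trace_inner (?E i j * X * transpose_mat (?E i j)) (P i j))
              = (if ij = (a, b) then trace_inner ?Y Q else 0)"
            by (auto simp: P_def)
        qed
        also have "\<dots> = trace_inner ?Y Q" using ab finite_index_pairs by simp
        also have "\<dots> = x \<bullet> (?Y *\<^sub>v x)"
          unfolding trace_inner_eq_sum[OF Y Qc] quadratic_form_eq_sum[OF Y x]
          by (intro sum.cong refl) (simp add: Q_def)
        finally show ?thesis .
      qed
      then show ?thesis using Y sY by (simp add: psd_mats_def sym_mats_def)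
    qed
    then show "X \<in> ?R" using Xs by auto
  next
    fix X assume R: "X \<in> ?R"
    then have Xs: "X \<in> sym_mats n" and X: "X \<in> carrier_mat n n" by (auto simp: sym_mats_def)
    have "0 \<le> trace_inner X Z" if "Z \<in> FW2 n \<alpha>" for Z
    proof -
      from that obtain P where P: "\<And>i j. (i, j) \<in> ?I \<Longrightarrow> P i j \<in> psd_mats (?k i j)"
        and Z: "Z = ?F P" unfolding FW2_def by blast
      have "trace_inner X Z
          = (\<Sum>(i, j)\<in>?I. trace_inner (?E i j * X * transpose_mat (?E i j)) (P i j))"
        unfolding Z using P by (intro tr[OF X]) (auto simp: psd_mats_def sym_mats_def)
      also have "\<dots> \<ge> 0"
        using R P by (intro sum_nonneg) (auto intro!: trace_inner_psd_nonneg)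
      finally show ?thesis .
    qed
    then show "X \<in> dual_cone n (FW2 n \<alpha>)" using Xs by (simp add: dual_cone_def)
  qed
qed

end

(* For X in the dual cone the matrices E_ij X E_ij^T are positive semidefinite, so
   Z = (sum over i < j of E_ij^T (E_ij X E_ij^T) E_ij) lies in FW2, and hence is positive semidefinite.
   This Z agrees with X off the diagonal blocks and with (p - 1) X on them. Therefore X - (2/p) Z
   equals (p - 2)/p X off the diagonal blocks and -(p - 2)/p X on them, and its norm is exactly
   (p - 2)/p times the norm of X. Positive semidefinite matrices belong to the dual
   cone, so this single approximant gives both bounds. *)

theory Submission
  imports Defs
begin

section \<open>Rank-one matrices and the chain of inclusions between the three cones\<close>

definition outer_mat :: "nat \<Rightarrow> real vec \<Rightarrow> real mat" where
  "outer_mat n x = mat n n (\<lambda>(r, c). x $ r * x $ c)"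

text \<open>The quadratic form of \<open>x x^T\<close> at \<open>y\<close> is the square of the
  inner product of \<open>x\<close> and \<open>y\<close>.\<close>

lemma outer_mat_psd: "outer_mat n x \<in> psd_mats n"
proof -
  have c: "outer_mat n x \<in> carrier_mat n n" by (simp add: outer_mat_def)
  have "0 \<le> y \<bullet> (outer_mat n x *\<^sub>v y)" if y: "y \<in> carrier_vec n" for y
  proof -
    have "y \<bullet> (outer_mat n x *\<^sub>v y) = (\<Sum>i<n. y $ i * x $ i)\<^sup>2"
      unfolding quadratic_form_eq_sum[OF c y] power2_eq_square sum_product
      by (intro sum.cong refl) (simp add: outer_mat_def)
    then show ?thesis by simp
  qed
  moreover have "transpose_mat (outer_mat n x) = outer_mat n x"
    by (rule eq_matI) (auto simp: outer_mat_def)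
  ultimately show ?thesis using c by (simp add: psd_mats_def sym_mats_def)
qed

text \<open>This links duality with definiteness: once a rank-one matrix is known to lie in a dual
  cone, its pairings give signs of quadratic forms.\<close>

lemma trace_inner_outer_mat:
  assumes "A \<in> carrier_mat n n" "x \<in> carrier_vec n"
  shows "trace_inner (outer_mat n x) A = x \<bullet> (A *\<^sub>v x)"
proof -
  have "outer_mat n x \<in> carrier_mat n n" by (simp add: outer_mat_def)
  then show ?thesis
    unfolding quadratic_form_eq_sum[OF assms]
    by (simp add: trace_inner_eq_sum[OF _ assms(1)] outer_mat_def ac_simps)
qed

lemma FW2_term_carrier:
  "transpose_mat (block_pair n \<alpha> i j) * Y * block_pair n \<alpha> i j \<in> carrier_mat n n"
  using carrier_matD(2)[OF block_pair_carrier[of n \<alpha> i j]] by (intro carrier_matI) simp_all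

text \<open>Moving \<open>E\<close> across the inner product turns the form of
  \<open>E X E^T\<close> at \<open>x\<close> into the form of \<open>X\<close> at
  \<open>E^T x\<close>.\<close>

lemma psd_congruence:
  assumes X: "X \<in> psd_mats n" and E: "E \<in> carrier_mat m n"
  shows "E * X * transpose_mat E \<in> psd_mats m"
proof -
  have Xc: "X \<in> carrier_mat n n" and sX: "transpose_mat X = X"
    using X by (auto simp: psd_mats_def sym_mats_def)
  have E': "transpose_mat E \<in> carrier_mat n m" using E by simp
  have EX: "E * X \<in> carrier_mat m n" using E Xc by simp
  have Y: "E * X * transpose_mat E \<in> carrier_mat m m" using EX E' by simp
  have "transpose_mat (E * X * transpose_mat E) = E * X * transpose_mat E"
    using transpose_mult[OF EX E'] transpose_mult[OF E Xc] assoc_mult_mat[OF E Xc E'] sX by simp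
  moreover have "0 \<le> x \<bullet> ((E * X * transpose_mat E) *\<^sub>v x)" if x: "x \<in> carrier_vec m" for x
  proof -
    define y where "y = transpose_mat E *\<^sub>v x"
    have y: "y \<in> carrier_vec n" using E' x by (simp add: y_def)
    have Xy: "X *\<^sub>v y \<in> carrier_vec n" using Xc y by simp
    have "(E * X * transpose_mat E) *\<^sub>v x = E *\<^sub>v (X *\<^sub>v y)"
      using assoc_mult_mat_vec[OF EX E' x] assoc_mult_mat_vec[OF E Xc y] by (simp add: y_def)
    also have "x \<bullet> \<dots> = y \<bullet> (X *\<^sub>v y)"
      unfolding y_def using transpose_vec_mult_scalar[OF E Xy x] by (simp add: y_def)
    finally show ?thesis using X y by (simp add: psd_mats_def)
  qed
  ultimately show ?thesis using Y by (simp add: psd_mats_def sym_mats_def)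
qed

text \<open>By \<open>dual_cone_FW2\<close> the dual cone constrains only the compressions of a
  symmetric matrix to pairs of blocks, and each compression is a congruence.\<close>

lemma psd_subset_dual_FW2: "psd_mats n \<subseteq> dual_cone n (FW2 n \<alpha>)"
proof -
  have "psd_mats n \<subseteq> sym_mats n" by (auto simp: psd_mats_def)
  then show ?thesis
    unfolding dual_cone_FW2 using psd_congruence[OF _ block_pair_carrier] by blast
qed

text \<open>Duality replaces an expansion of the sum that defines \<open>Z\<close>: the matrix
  \<open>x x^T\<close> is positive semidefinite, so it lies in the dual cone, and its pairing with
  \<open>Z\<close> is the quadratic form of \<open>Z\<close> at \<open>x\<close>.\<close>

lemma FW2_subset_psd: "FW2 n \<alpha> \<subseteq> psd_mats n"
proof
  fix Z assume Z: "Z \<in> FW2 n \<alpha>"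
  then have "Z \<in> sym_mats n" by (simp add: FW2_def)
  moreover have "0 \<le> x \<bullet> (Z *\<^sub>v x)" if "x \<in> carrier_vec n" for x
  proof -
    have "outer_mat n x \<in> dual_cone n (FW2 n \<alpha>)"
      using outer_mat_psd psd_subset_dual_FW2 by blast
    then have "0 \<le> trace_inner (outer_mat n x) Z" using Z by (simp add: dual_cone_def)
    then show ?thesis
      using trace_inner_outer_mat[of Z n x] \<open>Z \<in> sym_mats n\<close> that by (simp add: sym_mats_def)
  qed
  ultimately show "Z \<in> psd_mats n" by (simp add: psd_mats_def)
qed

text \<open>The factor 2/p is applied to X before Z is formed, so that the scaled approximant lies
  in \<open>FW2\<close> by the same construction.\<close>

lemma dual_cone_smult:
  assumes X: "X \<in> dual_cone n C" and a: "0 \<le> a" and C: "C \<subseteq> carrier_mat n n"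
  shows "a \<cdot>\<^sub>m X \<in> dual_cone n C"
proof -
  have Xc: "X \<in> carrier_mat n n" and sX: "transpose_mat X = X"
    using X by (auto simp: dual_cone_def sym_mats_def)
  have "transpose_mat (a \<cdot>\<^sub>m X) = a \<cdot>\<^sub>m X"
  proof (rule eq_matI)
    fix r c assume "r < dim_row (a \<cdot>\<^sub>m X)" "c < dim_col (a \<cdot>\<^sub>m X)"
    then show "transpose_mat (a \<cdot>\<^sub>m X) $$ (r, c) = (a \<cdot>\<^sub>m X) $$ (r, c)"
      using Xc sX index_transpose_mat(1)[of r X c] by simp
  qed (use Xc in auto)
  moreover have "0 \<le> trace_inner (a \<cdot>\<^sub>m X) Z" if "Z \<in> C" for Z
  proof -
    have Zc: "Z \<in> carrier_mat n n" using that C by blast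
    have "trace_inner (a \<cdot>\<^sub>m X) Z = a * trace_inner X Z"
      using Xc by (simp add: trace_inner_eq_sum[OF _ Zc] sum_distrib_left ac_simps)
    then show ?thesis using X a that by (simp add: dual_cone_def)
  qed
  ultimately show ?thesis using Xc by (simp add: dual_cone_def sym_mats_def)
qed

section \<open>Locating a row index in its block\<close>

definition block_of :: "nat list \<Rightarrow> nat \<Rightarrow> nat" where
  "block_of \<alpha> r = (LEAST i. r < sum_list (take (Suc i) \<alpha>))"

lemma sum_list_take_mono:
  fixes \<alpha> :: "nat list"
  assumes "i \<le> j"
  shows "sum_list (take i \<alpha>) \<le> sum_list (take j \<alpha>)"
  using assms take_add[of i "j - i" \<alpha>] by simp

lemma block_of_eq_iff:
  assumes "r < sum_list \<alpha>"
  shows "block_of \<alpha> r = i \<longleftrightarrow> sum_list (take i \<alpha>) \<le> r \<and> r < sum_list (take (Suc i) \<alpha>)"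
proof
  assume i: "block_of \<alpha> r = i"
  \<comment> \<open>\<open>take\<close> beyond the end returns the whole list, so the bound on
    \<open>r\<close> guarantees that the LEAST in \<open>block_of\<close> exists; otherwise its
    value would be unspecified.\<close>
  have "r < sum_list (take (Suc (length \<alpha>)) \<alpha>)" using assms by simp
  then have "r < sum_list (take (Suc i) \<alpha>)"
    unfolding i[symmetric] block_of_def by (rule LeastI)
  moreover have "sum_list (take i \<alpha>) \<le> r"
  proof (cases i)
    case (Suc m)
    then show ?thesis
      using not_less_Least[of m "\<lambda>i. r < sum_list (take (Suc i) \<alpha>)"] i by (auto simp: block_of_def)
  qed simp
  ultimately show "sum_list (take i \<alpha>) \<le> r \<and> r < sum_list (take (Suc i) \<alpha>)" by blast
next
  assume r: "sum_list (take i \<alpha>) \<le> r \<and> r < sum_list (take (Suc i) \<alpha>)"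
  \<comment> \<open>Partial sums are monotone, so an earlier block ends no later than block
    \<open>i\<close> starts.\<close>
  have "i \<le> y" if y: "r < sum_list (take (Suc y) \<alpha>)" for y
  proof (rule ccontr)
    assume "\<not> i \<le> y"
    then show False using sum_list_take_mono[of "Suc y" i \<alpha>] r y by simp
  qed
  then show "block_of \<alpha> r = i"
    unfolding block_of_def using r by (intro Least_equality) auto
qed

lemma block_of_less_length:
  assumes "r < sum_list \<alpha>"
  shows "block_of \<alpha> r < length \<alpha>"
proof (rule ccontr)
  assume "\<not> block_of \<alpha> r < length \<alpha>"
  then have "sum_list \<alpha> \<le> r" using block_of_eq_iff[OF assms, of "block_of \<alpha> r"] by simp
  then show False using assms by simp
qed

text \<open>Each column of a block row is a standard basis vector if its index lies in the block and
  zero otherwise, so the Gram matrix is the coordinate projection onto the block.\<close>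

lemma block_row_gram:
  assumes "i < length \<alpha>" "r < sum_list \<alpha>" "c < sum_list \<alpha>"
  shows "(\<Sum>a<\<alpha> ! i. block_row (sum_list \<alpha>) \<alpha> i $$ (a, r) * block_row (sum_list \<alpha>) \<alpha> i $$ (a, c))
    = (if r = c \<and> block_of \<alpha> r = i then 1 else 0)"
proof -
  let ?s = "sum_list (take i \<alpha>)"
  have le: "?s + \<alpha> ! i \<le> sum_list \<alpha>"
    using sum_list_take_mono[of "Suc i" "length \<alpha>" \<alpha>] assms(1) by (simp add: take_Suc_conv_app_nth)
  have entry: "block_row (sum_list \<alpha>) \<alpha> i $$ (a, c) = (if ?s + a = c then 1 else 0)"
    if "a < \<alpha> ! i" "c < sum_list \<alpha>" for a c
    using that le by (simp add: block_row_def)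
  \<comment> \<open>Only \<open>a = r - ?s\<close> can contribute. The subtraction truncates to 0
    for indices before the block; the guard \<open>?s \<le> r\<close> excludes them.\<close>
  have "(\<Sum>a<\<alpha> ! i. block_row (sum_list \<alpha>) \<alpha> i $$ (a, r) * block_row (sum_list \<alpha>) \<alpha> i $$ (a, c))
      = (\<Sum>a<\<alpha> ! i. if a = r - ?s then (if r = c \<and> ?s \<le> r then 1 else 0) else 0)"
    using assms by (intro sum.cong refl) (auto simp: entry)
  also have "\<dots> = (if r = c \<and> block_of \<alpha> r = i then 1 else 0)"
    using assms by (auto simp: block_of_eq_iff take_Suc_conv_app_nth)
  finally show ?thesis .
qed

section \<open>Gram matrices of block pairs and the count of overlapping pairs\<close>

lemma sum_lessThan_add:
  fixes f :: "nat \<Rightarrow> 'a :: comm_monoid_add"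
  shows "(\<Sum>a<m + n. f a) = (\<Sum>a<m. f a) + (\<Sum>a<n. f (m + a))"
  by (induction n) (simp_all add: ac_simps)

text \<open>Stacking rows adds Gram matrices. As \<open>i \<noteq> j\<close>, an index belongs to at
  most one of the two blocks, so the diagonal of the sum stays in {0, 1}.\<close>

lemma block_pair_gram:
  assumes "i < length \<alpha>" "j < length \<alpha>" "i \<noteq> j" and n: "n = sum_list \<alpha>"
  shows "transpose_mat (block_pair n \<alpha> i j) * block_pair n \<alpha> i j
    = mat_diag n (\<lambda>r. if block_of \<alpha> r \<in> {i, j} then 1 else 0)"
proof (rule eq_matI)
  let ?E = "block_pair n \<alpha> i j"
  have E: "dim_row ?E = \<alpha> ! i + \<alpha> ! j" "dim_col ?E = n"
    using block_pair_carrier[of n \<alpha> i j] by (auto simp del: block_pair_carrier)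
  have R: "dim_row (block_row n \<alpha> l) = \<alpha> ! l" "dim_col (block_row n \<alpha> l) = n" for l
    by (simp_all add: block_row_def)
  fix r c
  assume "r < dim_row (mat_diag n (\<lambda>r. if block_of \<alpha> r \<in> {i, j} then 1 else 0 :: real))"
    "c < dim_col (mat_diag n (\<lambda>r. if block_of \<alpha> r \<in> {i, j} then 1 else 0 :: real))"
  then have rc: "r < n" "c < n" by (auto simp: mat_diag_def)
  have top: "?E $$ (a, c) = block_row n \<alpha> i $$ (a, c)" if "a < \<alpha> ! i" "c < n" for a c
    using that R by (simp add: block_pair_def append_rows_def)
  have bot: "?E $$ (\<alpha> ! i + a, c) = block_row n \<alpha> j $$ (a, c)" if "a < \<alpha> ! j" "c < n" for a c
    using that R by (simp add: block_pair_def append_rows_def)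
  have "(transpose_mat ?E * ?E) $$ (r, c) = (\<Sum>a<\<alpha> ! i + \<alpha> ! j. ?E $$ (a, r) * ?E $$ (a, c))"
    using rc E by (simp add: scalar_prod_def atLeast0LessThan)
  also have "\<dots> = (\<Sum>a<\<alpha> ! i. block_row n \<alpha> i $$ (a, r) * block_row n \<alpha> i $$ (a, c))
      + (\<Sum>a<\<alpha> ! j. block_row n \<alpha> j $$ (a, r) * block_row n \<alpha> j $$ (a, c))"
    using rc by (simp add: sum_lessThan_add top bot)
  also have "\<dots> = mat_diag n (\<lambda>r. if block_of \<alpha> r \<in> {i, j} then 1 else 0) $$ (r, c)"
    using rc assms by (auto simp: block_row_gram mat_diag_def)
  finally show "(transpose_mat ?E * ?E) $$ (r, c)
    = mat_diag n (\<lambda>r. if block_of \<alpha> r \<in> {i, j} then 1 else 0) $$ (r, c)" .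
qed (use block_pair_carrier[of n \<alpha> i j] in \<open>auto simp: mat_diag_def simp del: block_pair_carrier\<close>)

text \<open>This is the multiplicity with which the sum over pairs covers block (b, d). An
  off-diagonal block is reached by one pair only; a diagonal one through its b smaller and p - 1 - b
  larger partners.\<close>

lemma card_index_pairs_containing:
  assumes "b < p" "d < p"
  shows "card {(i, j) \<in> index_pairs p. b \<in> {i, j} \<and> d \<in> {i, j}} = (if b = d then p - 1 else 1)"
proof (cases "b = d")
  case True
  have "{(i, j) \<in> index_pairs p. b \<in> {i, j} \<and> d \<in> {i, j}} = {..<b} \<times> {b} \<union> {b} \<times> {b<..<p}"
    using True assms by (auto simp: index_pairs_def)
  moreover have "card ({..<b} \<times> {b} \<union> {b} \<times> {b<..<p}) = b + (p - Suc b)"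
    by (subst card_Un_disjoint) (auto simp: card_cartesian_product)
  ultimately show ?thesis using True assms by simp
next
  case False
  then have "{(i, j) \<in> index_pairs p. b \<in> {i, j} \<and> d \<in> {i, j}} = {(min b d, max b d)}"
    using assms by (auto simp: index_pairs_def min_def max_def)
  then show ?thesis using False by simp
qed

section \<open>The approximant in closed form, and its error\<close>

definition block_weighted :: "nat \<Rightarrow> nat list \<Rightarrow> real mat \<Rightarrow> real mat" where
  "block_weighted n \<alpha> X = mat n n (\<lambda>(r, c).
     (if block_of \<alpha> r = block_of \<alpha> c then real (length \<alpha> - 1) else 1) * X $$ (r, c))"

text \<open>The compressions of X to pairs of blocks are the witnesses for \<open>FW2\<close>. Each
  summand is D X D with D the coordinate projection onto two blocks, so summing entrywise reduces to
  counting pairs.\<close>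

lemma block_weighted_in_FW2:
  assumes n: "n = sum_list \<alpha>" and dual: "X \<in> dual_cone n (FW2 n \<alpha>)"
  shows "block_weighted n \<alpha> X \<in> FW2 n \<alpha>"
proof -
  let ?I = "index_pairs (length \<alpha>)"
  let ?E = "block_pair n \<alpha>"
  define P where "P i j = ?E i j * X * transpose_mat (?E i j)" for i j
  let ?t = "\<lambda>(i, j). transpose_mat (?E i j) * P i j * ?E i j"
  let ?F = "finsum (module_mat TYPE(real) n n) ?t ?I"
  let ?d = "\<lambda>i j r. if block_of \<alpha> r \<in> {i, j} then 1 else 0 :: real"
  have X: "X \<in> carrier_mat n n" and sX: "transpose_mat X = X"
    using dual by (auto simp: dual_cone_def sym_mats_def)
  have psd: "P i j \<in> psd_mats (\<alpha> ! i + \<alpha> ! j)" if "(i, j) \<in> ?I" for i j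
    using dual that unfolding dual_cone_FW2 P_def by auto
  have tc: "?t ij \<in> carrier_mat n n" for ij
    using FW2_term_carrier by (cases ij) simp
  have Fc: "?F \<in> carrier_mat n n"
    using tc by (intro finsum_mat_carrier finite_index_pairs)
  have entry: "?t (i, j) $$ (r, c) = ?d i j r * ?d i j c * X $$ (r, c)"
    if "(i, j) \<in> ?I" and rc: "r < n" "c < n" for i j r c
  proof -
    have ij: "i < length \<alpha>" "j < length \<alpha>" "i \<noteq> j" using that by (auto simp: index_pairs_def)
    have E: "?E i j \<in> carrier_mat (\<alpha> ! i + \<alpha> ! j) n" by simp
    have T: "transpose_mat (?E i j) \<in> carrier_mat n (\<alpha> ! i + \<alpha> ! j)" by simp
    have G: "transpose_mat (?E i j) * ?E i j \<in> carrier_mat n n" using mult_carrier_mat[OF T E] .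
    have EX: "?E i j * X \<in> carrier_mat (\<alpha> ! i + \<alpha> ! j) n" using mult_carrier_mat[OF E X] .
    have TEX: "transpose_mat (?E i j) * (?E i j * X) \<in> carrier_mat n n"
      using mult_carrier_mat[OF T EX] .
    \<comment> \<open>Regrouping E^T (E X E^T) E exposes the Gram matrix E^T E on both sides of
      X.\<close>
    have "?t (i, j) = (transpose_mat (?E i j) * (?E i j * X)) * (transpose_mat (?E i j) * ?E i j)"
      unfolding P_def prod.case assoc_mult_mat[OF T EX T, symmetric]
      by (rule assoc_mult_mat[OF TEX T E])
    also have "\<dots> = (transpose_mat (?E i j) * ?E i j) * X * (transpose_mat (?E i j) * ?E i j)"
      by (simp only: assoc_mult_mat[OF T E X])
    also have "\<dots> = mat_diag n (?d i j) * X * mat_diag n (?d i j)"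
      by (simp only: block_pair_gram[OF ij n])
    also have "\<dots> $$ (r, c) = ?d i j r * ?d i j c * X $$ (r, c)"
      using X rc by (simp add: mat_diag_mult_left[of _ n n] mat_diag_mult_right[of _ n n])
    finally show ?thesis .
  qed
  have "block_weighted n \<alpha> X = ?F"
  proof (rule eq_matI)
    fix r c assume "r < dim_row ?F" "c < dim_col ?F"
    then have rc: "r < n" "c < n" using Fc by auto
    then have b: "block_of \<alpha> r < length \<alpha>" "block_of \<alpha> c < length \<alpha>"
      using n block_of_less_length by auto
    let ?S = "{(i, j) \<in> ?I. block_of \<alpha> r \<in> {i, j} \<and> block_of \<alpha> c \<in> {i, j}}"
    have "?F $$ (r, c) = (\<Sum>ij\<in>?I. ?t ij $$ (r, c))"
      by (rule index_finsum_mat[OF finite_index_pairs tc rc])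
    \<comment> \<open>The product of the two 0/1 weights is 1 exactly when the pair contains the
      blocks of both \<open>r\<close> and \<open>c\<close>.\<close>
    also have "\<dots> = (\<Sum>ij\<in>?I. if ij \<in> ?S then X $$ (r, c) else 0)"
    proof (rule sum.cong[OF refl])
      fix ij assume "ij \<in> ?I"
      then show "?t ij $$ (r, c) = (if ij \<in> ?S then X $$ (r, c) else 0)"
        using entry[OF _ rc] by (cases ij) (simp del: insert_iff)
    qed
    also have "\<dots> = (\<Sum>ij\<in>?S. X $$ (r, c))"
      by (rule sum.mono_neutral_cong_right[OF finite_index_pairs]) auto
    also have "\<dots> = block_weighted n \<alpha> X $$ (r, c)"
      using rc by (simp only: sum_constant card_index_pairs_containing[OF b])
        (simp add: block_weighted_def)
    finally show "block_weighted n \<alpha> X $$ (r, c) = ?F $$ (r, c)" ..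
  qed (use Fc in \<open>auto simp: block_weighted_def\<close>)
  moreover have "block_weighted n \<alpha> X \<in> sym_mats n"
  proof -
    have "X $$ (c, r) = X $$ (r, c)" if "r < n" "c < n" for r c
      using that X sX index_transpose_mat(1)[of r X c] by simp
    then have "transpose_mat (block_weighted n \<alpha> X) = block_weighted n \<alpha> X"
      by (intro eq_matI) (auto simp: block_weighted_def)
    then show ?thesis by (simp add: sym_mats_def block_weighted_def)
  qed
  ultimately show ?thesis unfolding FW2_def using psd by blast
qed

text \<open>The scale a = 2/p balances the error factors: it solves 1 - a = (p - 1) a - 1. All
  entries are then multiplied by the same number up to sign, which squaring removes.\<close>

lemma frobenius_norm_block_weighted:
  assumes X: "X \<in> carrier_mat n n" and p: "length \<alpha> \<ge> 2"
  shows "frobenius_norm (X - block_weighted n \<alpha> ((2 / real (length \<alpha>)) \<cdot>\<^sub>m X))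
    = (real (length \<alpha>) - 2) / real (length \<alpha>) * frobenius_norm X"
proof -
  let ?p = "real (length \<alpha>)" and ?q = "(real (length \<alpha>) - 2) / real (length \<alpha>)"
  let ?W = "block_weighted n \<alpha> ((2 / ?p) \<cdot>\<^sub>m X)"
  have W: "?W \<in> carrier_mat n n" by (simp add: block_weighted_def)
  have p0: "0 < ?p" using p by linarith
  have diag: "x - (t - 1) * (2 / t * x) = - ((t - 2) / t) * x"
    and off: "x - 2 / t * x = (t - 2) / t * x" if "0 < t" for t x :: real
    using that by (simp_all add: field_simps)
  have "((X - ?W) $$ (r, c))\<^sup>2 = ?q\<^sup>2 * (X $$ (r, c))\<^sup>2" if rc: "r < n" "c < n" for r c
  proof (cases "block_of \<alpha> r = block_of \<alpha> c")
    case True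
    have "(X - ?W) $$ (r, c) = X $$ (r, c) - (?p - 1) * (2 / ?p * X $$ (r, c))"
      using rc X True p by (simp add: block_weighted_def of_nat_diff)
    also have "\<dots> = - ?q * X $$ (r, c)" using diag[OF p0] .
    finally show ?thesis by (simp add: power_mult_distrib power_divide power2_commute)
  next
    case False
    have "(X - ?W) $$ (r, c) = X $$ (r, c) - 2 / ?p * X $$ (r, c)"
      using rc X False by (simp add: block_weighted_def)
    also have "\<dots> = ?q * X $$ (r, c)" using off[OF p0] .
    finally show ?thesis by (simp only: power_mult_distrib)
  qed
  then have "(\<Sum>r<n. \<Sum>c<n. ((X - ?W) $$ (r, c))\<^sup>2) = ?q\<^sup>2 * (\<Sum>r<n. \<Sum>c<n. (X $$ (r, c))\<^sup>2)"
    by (simp add: sum_distrib_left)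
  \<comment> \<open>Here p \<ge> 2 makes the factor nonnegative, so the square root of its square is
    the factor itself.\<close>
  moreover have "dim_row (X - ?W) = n" "dim_col (X - ?W) = n" "\<bar>?p - 2\<bar> = ?p - 2"
    using X W p by auto
  ultimately show ?thesis
    using X by (simp add: frobenius_norm_def real_sqrt_mult)
qed

section \<open>Bounding the infimum and the supremum in the distances\<close>

lemma mat_dist_le:
  assumes "N \<in> D"
  shows "mat_dist M D \<le> frobenius_norm (M - N)"
  \<comment> \<open>A real infimum is a lower bound only for sets bounded below; norms are bounded
    below by 0.\<close>
  unfolding mat_dist_def
  by (rule cINF_lower[OF bdd_belowI2[of _ 0] assms]) (simp add: frobenius_norm_def sum_nonneg)

text \<open>A pointwise bound passes to a real supremum only over a nonempty set. The unit-norm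
  witness is the rank-one matrix whose sole nonzero entry is a 1 at (0, 0); it exists because
  \<open>0 < n\<close>.\<close>

lemma cone_dist_le:
  assumes n: "0 < n" and C: "psd_mats n \<subseteq> C"
    and le: "\<And>M. M \<in> C \<Longrightarrow> frobenius_norm M = 1 \<Longrightarrow> mat_dist M D \<le> q"
  shows "cone_dist C D \<le> q"
proof -
  let ?U = "outer_mat n (unit_vec n 0)"
  have "(\<Sum>i<n. \<Sum>j<n. (?U $$ (i, j))\<^sup>2) = (\<Sum>i<n. if i = 0 then 1 else 0)"
  proof (rule sum.cong[OF refl])
    fix i assume "i \<in> {..<n}"
    then have "(\<Sum>j<n. (?U $$ (i, j))\<^sup>2) = (\<Sum>j<n. if j = 0 then (if i = 0 then 1 else 0) else 0)"
      by (intro sum.cong refl) (auto simp: outer_mat_def)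
    then show "(\<Sum>j<n. (?U $$ (i, j))\<^sup>2) = (if i = 0 then 1 else 0)" using n by simp
  qed
  then have "frobenius_norm ?U = 1"
    using n by (simp add: frobenius_norm_def) (simp add: outer_mat_def)
  then have "{M \<in> C. frobenius_norm M = 1} \<noteq> {}" using outer_mat_psd C by blast
  then show ?thesis unfolding cone_dist_def using le by (intro cSUP_least) auto
qed

theorem proposition2:
  fixes \<alpha> :: "nat list" and n :: nat
  assumes "is_partition \<alpha> n"
    and "length \<alpha> \<ge> 2"
  shows "cone_dist (psd_mats n) (FW2 n \<alpha>) \<le> (real (length \<alpha>) - 2) / real (length \<alpha>) \<and>
    cone_dist (dual_cone n (FW2 n \<alpha>)) (psd_mats n) \<le> (real (length \<alpha>) - 2) / real (length \<alpha>)"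
proof -
  let ?q = "(real (length \<alpha>) - 2) / real (length \<alpha>)"
  let ?W = "\<lambda>M. block_weighted n \<alpha> ((2 / real (length \<alpha>)) \<cdot>\<^sub>m M)"
  have n: "n = sum_list \<alpha>" using assms(1) by (simp add: is_partition_def)
  have "0 < n"
    using assms by (cases \<alpha>) (auto simp: is_partition_def)
  have FWc: "FW2 n \<alpha> \<subseteq> carrier_mat n n" by (auto simp: FW2_def sym_mats_def)
  \<comment> \<open>The approximation is stated on the dual cone, the largest of the three, so that
    it serves both bounds.\<close>
  have approx: "?W M \<in> FW2 n \<alpha> \<and> frobenius_norm (M - ?W M) = ?q"
    if "M \<in> dual_cone n (FW2 n \<alpha>)" "frobenius_norm M = 1" for M
  proof -
    have "M \<in> carrier_mat n n" using that by (simp add: dual_cone_def sym_mats_def)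
    then show ?thesis
      using block_weighted_in_FW2[OF n dual_cone_smult[OF that(1) _ FWc]]
        frobenius_norm_block_weighted[of M n \<alpha>] assms(2) that(2) by simp
  qed
  have "cone_dist (psd_mats n) (FW2 n \<alpha>) \<le> ?q"
  proof (rule cone_dist_le[OF \<open>0 < n\<close> subset_refl])
    fix M assume "M \<in> psd_mats n" "frobenius_norm M = 1"
    then have "?W M \<in> FW2 n \<alpha>" "frobenius_norm (M - ?W M) = ?q"
      using approx psd_subset_dual_FW2 by blast+
    then show "mat_dist M (FW2 n \<alpha>) \<le> ?q" using mat_dist_le by metis
  qed
  moreover have "cone_dist (dual_cone n (FW2 n \<alpha>)) (psd_mats n) \<le> ?q"
  proof (rule cone_dist_le[OF \<open>0 < n\<close> psd_subset_dual_FW2])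
    fix M assume "M \<in> dual_cone n (FW2 n \<alpha>)" "frobenius_norm M = 1"
    \<comment> \<open>The same approximant is admissible here because \<open>FW2\<close> lies inside
      the positive semidefinite cone.\<close>
    then have "?W M \<in> psd_mats n" "frobenius_norm (M - ?W M) = ?q"
      using approx FW2_subset_psd by blast+
    then show "mat_dist M (psd_mats n) \<le> ?q" using mat_dist_le by metis
  qed
  ultimately show ?thesis by blast
qed

end
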